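(* Let $m,a\ge 1$ be integers and let $K^{(m)}_a$ be the complete $m$-partite graph with $a$ vertices in each partite set. The minimum defect in a $2$-coloring of $K^{(m)}_a$ is \[ D(K^{(m)}_a,2)=\left(\lceil m/2\rceil-1\right)a . \]
   Context: Graphs are finite and simple. For a graph $G$ and a positive integer $k$, a (fractional) $k$-coloring of $G$ is an assignment to every vertex $v$ of real numbers $f_1(v),\dots,f_k(v)\ge 0$ with $\sum_{j=1}^k f_j(v)=1$ ($f_j(v)$ is the usage of color $j$ at $v$). The defect of $v$ is $\mathrm{df}(v)=\sum_{w\in N(v)}\sum_{j=1}^k\min(f_j(v),f_j(w))$, where $N(v)$ is the set of neighbors of $v$. The defect of the coloring is $\max_v \mathrm{df}(v)$, and the minimum defect $D(G,k)$ is the minimum of this quantity over all $k$-colorings of $G$. *)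

theory Defs
  imports
    Complex_Main
    "HOL-Library.Disjoint_Sets"
    "Graph_Theory.Digraph"
begin

text \<open>
  Finite simple graphs are the symmetric loop-free digraphs without parallel arcs of the locale
  \<^locale>\<open>graph\<close>: each undirected edge \<open>{u, v}\<close> is represented by the two arcs
  \<open>(u, v)\<close> and \<open>(v, u)\<close>.
\<close>

definition neighbors :: "('v, 'e) pre_digraph \<Rightarrow> 'v \<Rightarrow> 'v set" where
  "neighbors G v = {w. v \<rightarrow>\<^bsub>G\<^esub> w}"

text \<open>The value \<open>f v j\<close> is the usage of color \<open>j\<close> at the vertex \<open>v\<close>.\<close>

definition fractional_coloring ::
  "('v, 'e) pre_digraph \<Rightarrow> nat \<Rightarrow> ('v \<Rightarrow> nat \<Rightarrow> real) \<Rightarrow> bool" where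
  "fractional_coloring G k f \<longleftrightarrow>
     (\<forall>v\<in>verts G. (\<forall>j\<in>{1..k}. 0 \<le> f v j) \<and> (\<Sum>j=1..k. f v j) = 1)"

definition vertex_defect ::
  "('v, 'e) pre_digraph \<Rightarrow> nat \<Rightarrow> ('v \<Rightarrow> nat \<Rightarrow> real) \<Rightarrow> 'v \<Rightarrow> real" where
  "vertex_defect G k f v = (\<Sum>w\<in>neighbors G v. \<Sum>j=1..k. min (f v j) (f w j))"

definition coloring_defect ::
  "('v, 'e) pre_digraph \<Rightarrow> nat \<Rightarrow> ('v \<Rightarrow> nat \<Rightarrow> real) \<Rightarrow> real" where
  "coloring_defect G k f = Max (vertex_defect G k f ` verts G)"

text \<open>
  A genuine minimum: for a graph with at least one vertex and \<open>k \<ge> 1\<close> it exists by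
  compactness, and otherwise the value is unspecified.
\<close>

definition min_defect :: "('v, 'e) pre_digraph \<Rightarrow> nat \<Rightarrow> real" where
  "min_defect G k = (LEAST d. \<exists>f. fractional_coloring G k f \<and> d = coloring_defect G k f)"

text \<open>
  \<open>G\<close> is (a copy of) the complete \<open>m\<close>-partite graph with \<open>a\<close> vertices in each partite set.
  Since \<^const>\<open>partition_on\<close> excludes empty blocks, this is meant for \<open>a \<ge> 1\<close>.
\<close>

definition complete_multipartite :: "nat \<Rightarrow> nat \<Rightarrow> ('v, 'e) pre_digraph \<Rightarrow> bool" where
  "complete_multipartite m a G \<longleftrightarrow> graph G \<and>
     (\<exists>P. partition_on (verts G) P \<and> card P = m \<and> (\<forall>U\<in>P. card U = a) \<and>
       arcs_ends G = {(u, v) \<in> verts G \<times> verts G. \<not> (\<exists>U\<in>P. u \<in> U \<and> v \<in> U)})"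

end

theory Submission
  imports Defs
begin

text \<open>
  Let \<open>n = \<lceil>m/2\<rceil> - 1\<close>, so that \<open>m\<close> is \<open>2n + 1\<close> or \<open>2n + 2\<close>. A \<open>2\<close>-coloring
  is determined by the usage \<open>x\<^sub>v \<in> [0, 1]\<close> of the first color, and an edge \<open>vw\<close> contributes
  \<open>1 - \<bar>x\<^sub>v - x\<^sub>w\<bar>\<close> to the defect of each of its ends.

  Upper bound: give \<open>n + 1\<close> partite sets the first color and the other sets, at most \<open>n + 1\<close> of
  them, the second. Every vertex then shares its color with at most \<open>n\<close> partite sets besides its
  own.

  Lower bound: keep only \<open>2n + 1\<close> of the partite sets, which does not increase any defect. A vertex
  has \<open>2na\<close> neighbors there, so it suffices to find one whose distances \<open>\<bar>x\<^sub>v - x\<^sub>w\<bar>\<close> to them add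
  up to at most \<open>na\<close>. For a partite set \<open>U\<close>, the sums of \<open>x\<^sub>w\<close> and of \<open>1 - x\<^sub>w\<close> over the
  \<open>2na\<close> vertices outside \<open>U\<close> add up to \<open>2na\<close>, so one of them is at most \<open>na\<close>. By pigeonhole
  the same one of the two is small for \<open>n + 1\<close> of the sets, and after swapping the colors it is the
  sum of the \<open>x\<^sub>w\<close>. Among the vertices of these \<open>n + 1\<close> sets take one, \<open>v \<in> U\<close>, with smallest
  \<open>x\<^sub>v\<close>. The \<open>na\<close> vertices in the other \<open>n\<close> chosen sets have distance \<open>x\<^sub>w - x\<^sub>v\<close> from
  \<open>v\<close>, and the \<open>na\<close> vertices in the remaining \<open>n\<close> sets have distance at most \<open>x\<^sub>w + x\<^sub>v\<close>. On
  adding up, the terms \<open>x\<^sub>v\<close> cancel and the sum of the \<open>x\<^sub>w\<close> remains, which is at most \<open>na\<close>.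
  The cancellation rests on having \<open>n\<close> sets of either kind besides \<open>U\<close>, hence an odd number in
  all. The argument is carried out in \<open>low_majority\<close> and \<open>small_distance_sum\<close>.
\<close>

section \<open>Points in equal-sized blocks\<close>

lemma card_Union_equal_blocks:
  fixes a :: nat
  assumes "finite P" "disjoint P" "\<forall>U\<in>P. card U = a" "1 \<le> a"
  shows "finite (\<Union>P)" and "card (\<Union>P) = card P * a"
proof -
  have "finite U" if "U \<in> P" for U
    using assms(3,4) that by (intro card_ge_0_finite) auto
  then show fin: "finite (\<Union>P)"
    using assms(1) by auto
  have "a * card P = card (\<Union>P)"
    using assms by (intro card_partition fin) (auto simp: disjoint_def)
  then show "card (\<Union>P) = card P * a"
    by (simp add: mult.commute)
qed

text \<open>
  This is the half of the pigeonhole argument in which low values prevail. Exactly \<open>n + 1\<close> blocks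
  are taken into \<open>T\<close>, so that for each \<open>U \<in> T\<close> equally many points outside \<open>U\<close> lie inside and
  outside \<open>\<Union>T\<close>. A minimum of \<open>x\<close> on \<open>\<Union>T\<close> therefore enters the two partial sums equally often
  with opposite signs.
\<close>

lemma low_majority:
  fixes x :: "'v \<Rightarrow> real" and a n :: nat
  assumes Q: "finite Q" "disjoint Q" "\<forall>U\<in>Q. card U = a" "1 \<le> a" "card Q = 2 * n + 1"
    and x0: "\<forall>w\<in>\<Union>Q. 0 \<le> x w"
    and T: "T \<subseteq> Q" "card T = n + 1" "\<forall>U\<in>T. (\<Sum>w\<in>\<Union>Q - U. x w) \<le> real n * real a"
  shows "\<exists>U\<in>T. \<exists>v\<in>U. (\<Sum>w\<in>\<Union>Q - U. \<bar>x v - x w\<bar>) \<le> real n * real a"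
proof -
  have finT: "finite T" using T(1) Q(1) finite_subset by blast
  have sub: "finite (\<Union>S)" "card (\<Union>S) = card S * a" if "S \<subseteq> Q" for S
    using card_Union_equal_blocks[of S a] that Q(1-4) finite_subset[OF that]
    by (auto intro: pairwise_subset)
  have "card (\<Union>T) \<noteq> 0"
    using sub(2)[OF T(1)] T(2) Q(4) by simp
  then have "\<Union>T \<noteq> {}"
    by (metis card.empty)
  then obtain v where v: "v \<in> \<Union>T" "\<forall>w\<in>\<Union>T. x v \<le> x w"
    using sub(1)[OF T(1)] ex_min_if_finite[of "x ` \<Union>T"]
    by (metis (no_types, lifting) arg_min_if_finite(1) arg_min_least)
  then obtain U where U: "U \<in> T" "v \<in> U" by blast
  let ?A = "\<Union>(T - {U})" and ?B = "\<Union>(Q - T)"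
  have disj: "V \<inter> W = {}" if "V \<in> Q" "W \<in> Q" "V \<noteq> W" for V W
    using Q(2) that by (auto simp: disjoint_def)
  have split: "\<Union>Q - U = ?A \<union> ?B"
    using disj T(1) U(1) by blast
  have AB: "?A \<inter> ?B = {}"
    using disj T(1) by blast
  have subs: "T - {U} \<subseteq> Q" "Q - T \<subseteq> Q" using T(1) by auto
  have cA: "card ?A = n * a"
    using sub(2)[OF subs(1)] T(2) U(1) finT by simp
  have cB: "card ?B = n * a"
    using sub(2)[OF subs(2)] T(1,2) Q(5) finT by (simp add: card_Diff_subset)
  have "(\<Sum>w\<in>\<Union>Q - U. \<bar>x v - x w\<bar>) = (\<Sum>w\<in>?A. \<bar>x v - x w\<bar>) + (\<Sum>w\<in>?B. \<bar>x v - x w\<bar>)"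
    unfolding split by (intro sum.union_disjoint sub subs AB)
  also have "\<dots> \<le> (\<Sum>w\<in>?A. x w - x v) + (\<Sum>w\<in>?B. x w + x v)"
  proof (intro add_mono sum_mono)
    show "\<bar>x v - x w\<bar> \<le> x w - x v" if "w \<in> ?A" for w
    proof -
      have "x v \<le> x w" using v(2) that by blast
      then show ?thesis by simp
    qed
    show "\<bar>x v - x w\<bar> \<le> x w + x v" if "w \<in> ?B" for w
    proof -
      have "0 \<le> x w" "0 \<le> x v" using x0 that T(1) v(1) by blast+
      then show ?thesis by simp
    qed
  qed
  also have "\<dots> = (\<Sum>w\<in>?A. x w) + (\<Sum>w\<in>?B. x w)"
    unfolding sum_subtractf sum.distrib by (simp add: cA cB)
  also have "\<dots> = (\<Sum>w\<in>\<Union>Q - U. x w)"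
    unfolding split by (intro sum.union_disjoint[symmetric] sub subs AB)
  also have "\<dots> \<le> real n * real a"
    using T(3) U(1) by blast
  finally show ?thesis using U by blast
qed

text \<open>
  Distances are unchanged by \<open>x \<mapsto> 1 - x\<close>, so both outcomes of the pigeonhole argument are
  instances of \<open>low_majority\<close>. The bound is sharp: if \<open>a\<close> is even and \<open>x\<close> is \<open>0\<close> on half of
  each block and \<open>1\<close> on the other half, every point has distance sum exactly \<open>na\<close>.
\<close>

lemma small_distance_sum:
  fixes x :: "'v \<Rightarrow> real" and a n :: nat
  assumes Q: "finite Q" "disjoint Q" "\<forall>U\<in>Q. card U = a" "1 \<le> a" "card Q = 2 * n + 1"
    and x: "\<forall>w\<in>\<Union>Q. 0 \<le> x w \<and> x w \<le> 1"
  shows "\<exists>U\<in>Q. \<exists>v\<in>U. (\<Sum>w\<in>\<Union>Q - U. \<bar>x v - x w\<bar>) \<le> real n * real a"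
proof -
  define L where "L = {U\<in>Q. (\<Sum>w\<in>\<Union>Q - U. x w) \<le> real n * real a}"
  have LQ: "L \<subseteq> Q" unfolding L_def by blast
  have "card (Q - L) = card Q - card L"
    using LQ Q(1) by (simp add: card_Diff_subset finite_subset)
  then consider "n + 1 \<le> card L" | "n + 1 \<le> card (Q - L)"
    using Q(5) by linarith
  then show ?thesis
  proof cases
    case 1
    then obtain T where T: "T \<subseteq> L" "card T = n + 1"
      by (metis obtain_subset_with_card_n)
    then have "\<exists>U\<in>T. \<exists>v\<in>U. (\<Sum>w\<in>\<Union>Q - U. \<bar>x v - x w\<bar>) \<le> real n * real a"
      using x LQ by (intro low_majority[OF Q]) (auto simp: L_def)
    then show ?thesis using T LQ by blast
  next
    case 2
    then obtain T where T: "T \<subseteq> Q - L" "card T = n + 1"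
      by (metis obtain_subset_with_card_n)
    have low: "(\<Sum>w\<in>\<Union>Q - U. 1 - x w) \<le> real n * real a" if "U \<in> T" for U
    proof -
      have U: "U \<in> Q" "(\<Sum>w\<in>\<Union>Q - U. x w) > real n * real a"
        using T(1) that unfolding L_def by auto
      have "card (\<Union>Q - U) = 2 * n * a"
        using card_Union_equal_blocks[OF Q(1-4)] Q(3,5) U(1)
        by (subst card_Diff_subset) (auto intro: finite_subset[of U "\<Union>Q"])
      then show ?thesis
        using U(2) by (simp add: sum_subtractf algebra_simps)
    qed
    have "\<exists>U\<in>T. \<exists>v\<in>U. (\<Sum>w\<in>\<Union>Q - U. \<bar>(1 - x v) - (1 - x w)\<bar>) \<le> real n * real a"
      using x T low by (intro low_majority[OF Q]) auto
    then have "\<exists>U\<in>T. \<exists>v\<in>U. (\<Sum>w\<in>\<Union>Q - U. \<bar>x v - x w\<bar>) \<le> real n * real a"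
      by (simp add: abs_minus_commute)
    then show ?thesis using T by blast
  qed
qed

section \<open>Two-colorings of complete multipartite graphs\<close>

lemma neighbors_complete_multipartite:
  assumes "partition_on (verts G) P"
    and "arcs_ends G = {(u, v) \<in> verts G \<times> verts G. \<not> (\<exists>U\<in>P. u \<in> U \<and> v \<in> U)}"
    and "U \<in> P" "v \<in> U"
  shows "neighbors G v = \<Union>P - U"
proof -
  have V: "verts G = \<Union>P" using assms(1) by (simp add: partition_on_def)
  have same_block: "W = U" if "W \<in> P" "v \<in> W" for W
    using assms(1,3,4) that by (auto simp: partition_on_def disjoint_def)
  have "v \<in> \<Union>P" using assms(3,4) by blast
  then have "w \<in> neighbors G v \<longleftrightarrow> w \<in> \<Union>P \<and> \<not> (\<exists>W\<in>P. v \<in> W \<and> w \<in> W)" for w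
    unfolding neighbors_def assms(2) V by simp
  moreover have "(\<exists>W\<in>P. v \<in> W \<and> w \<in> W) \<longleftrightarrow> w \<in> U" for w
    using same_block assms(3,4) by blast
  ultimately show ?thesis by blast
qed

lemma vertex_defect_two_colors:
  assumes f: "fractional_coloring G 2 f" and v: "v \<in> verts G" and N: "neighbors G v \<subseteq> verts G"
  shows "vertex_defect G 2 f v = (\<Sum>w\<in>neighbors G v. 1 - \<bar>f v 1 - f w 1\<bar>)"
proof -
  have two: "{1..2} = {1, 2::nat}" by auto
  have compl: "f u 2 = 1 - f u 1" if "u \<in> verts G" for u
    using f that unfolding fractional_coloring_def two by fastforce
  show ?thesis
    unfolding vertex_defect_def
  proof (rule sum.cong[OF refl])
    fix w assume "w \<in> neighbors G v"
    then have "f w 2 = 1 - f w 1" "f v 2 = 1 - f v 1"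
      using N v compl by auto
    then show "(\<Sum>j=1..2. min (f v j) (f w j)) = 1 - \<bar>f v 1 - f w 1\<bar>"
      unfolding two by (simp add: min_def abs_if)
  qed
qed

text \<open>
  Keeping an odd number of the partite sets loses nothing: \<open>\<lceil>m/2\<rceil>\<close> is the same for \<open>2n + 1\<close>
  and \<open>2n + 2\<close>, and discarded neighbors contribute nonnegatively to the defect.
\<close>

lemma coloring_defect_lower_bound:
  assumes G: "finite (verts G)" "partition_on (verts G) P"
      "arcs_ends G = {(u, v) \<in> verts G \<times> verts G. \<not> (\<exists>U\<in>P. u \<in> U \<and> v \<in> U)}"
    and P: "\<forall>U\<in>P. card U = a" "1 \<le> a" "2 * n + 1 \<le> card P"
    and f: "fractional_coloring G 2 f"
  shows "real n * real a \<le> coloring_defect G 2 f"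
proof -
  have V: "verts G = \<Union>P" and dP: "disjoint P"
    using G(2) by (auto simp: partition_on_def)
  obtain Q where Q: "Q \<subseteq> P" "card Q = 2 * n + 1" "finite Q"
    using P(3) by (metis obtain_subset_with_card_n)
  have Q': "disjoint Q" "\<forall>U\<in>Q. card U = a"
    using Q(1) dP P(1) by (auto intro: pairwise_subset)
  have x: "0 \<le> f w 1 \<and> f w 1 \<le> 1" if "w \<in> verts G" for w
  proof -
    have two: "{1..2} = {1, 2::nat}" by auto
    have "0 \<le> f w 1" "0 \<le> f w 2" "f w 1 + f w 2 = 1"
      using f that unfolding fractional_coloring_def two by auto
    then show ?thesis by linarith
  qed
  obtain U v where U: "U \<in> Q" "v \<in> U"
    and small: "(\<Sum>w\<in>\<Union>Q - U. \<bar>f v 1 - f w 1\<bar>) \<le> real n * real a"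
    using small_distance_sum[OF Q(3) Q' P(2) Q(2), of "\<lambda>w. f w 1"] x V Q(1) by blast
  have vV: "v \<in> verts G" using U Q(1) V by blast
  have N: "neighbors G v = \<Union>P - U"
    using neighbors_complete_multipartite[OF G(2,3)] U Q(1) by blast
  have "card (\<Union>Q - U) = 2 * n * a"
    using card_Union_equal_blocks[OF Q(3) Q' P(2)] Q(2) Q'(2) U(1)
    by (subst card_Diff_subset) (auto intro: finite_subset[of U "\<Union>Q"])
  then have "real n * real a \<le> (\<Sum>w\<in>\<Union>Q - U. 1 - \<bar>f v 1 - f w 1\<bar>)"
    using small by (simp add: sum_subtractf algebra_simps)
  also have "\<dots> \<le> (\<Sum>w\<in>\<Union>P - U. 1 - \<bar>f v 1 - f w 1\<bar>)"
  proof (rule sum_mono2)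
    show "0 \<le> 1 - \<bar>f v 1 - f w 1\<bar>" if "w \<in> \<Union>P - U - (\<Union>Q - U)" for w
    proof -
      have "w \<in> verts G" using that V by blast
      then show ?thesis using x[of w] x[OF vV] by linarith
    qed
  qed (use G(1) V Q(1) in auto)
  also have "\<dots> = vertex_defect G 2 f v"
    using vertex_defect_two_colors[OF f vV] V unfolding N by auto
  also have "\<dots> \<le> coloring_defect G 2 f"
    unfolding coloring_defect_def using G(1) vV by auto
  finally show ?thesis .
qed

lemma coloring_with_small_defect:
  assumes G: "finite (verts G)" "partition_on (verts G) P" "verts G \<noteq> {}"
      "arcs_ends G = {(u, v) \<in> verts G \<times> verts G. \<not> (\<exists>U\<in>P. u \<in> U \<and> v \<in> U)}"
    and P: "\<forall>U\<in>P. card U = a" "1 \<le> a" "n + 1 \<le> card P" "card P \<le> 2 * n + 2"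
  shows "\<exists>f. fractional_coloring G 2 f \<and> coloring_defect G 2 f \<le> real n * real a"
proof -
  have V: "verts G = \<Union>P" and dP: "disjoint P"
    using G(2) by (auto simp: partition_on_def)
  have finP: "finite P" using P(3) by (intro card_ge_0_finite) auto
  have disj: "W \<inter> X = {}" if "W \<in> P" "X \<in> P" "W \<noteq> X" for W X
    using dP that by (auto simp: disjoint_def)
  obtain H where H: "H \<subseteq> P" "card H = n + 1" "finite H"
    using P(3) by (metis obtain_subset_with_card_n)
  define f :: "_ \<Rightarrow> nat \<Rightarrow> real" where "f v j = of_bool ((v \<in> \<Union>H) = (j = 1))" for v j
  have two: "{1..2} = {1, 2::nat}" by auto
  have "0 \<le> f v j" "f v 1 + f v 2 = 1" for v j
    by (auto simp: f_def)
  then have f: "fractional_coloring G 2 f"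
    unfolding fractional_coloring_def two by simp
  have "vertex_defect G 2 f v \<le> real n * real a" if vV: "v \<in> verts G" for v
  proof -
    obtain U where U: "U \<in> P" "v \<in> U" using vV unfolding V by blast
    have N: "neighbors G v = \<Union>P - U"
      using neighbors_complete_multipartite[OF G(2,4) U] .
    \<comment> \<open>the partite sets other than \<open>U\<close> that have the color of \<open>v\<close>\<close>
    define S where "S = (if U \<in> H then H else P - H) - {U}"
    have S: "S \<subseteq> P" using H(1) unfolding S_def by auto
    have "card S \<le> n"
      using U(1) H P(4) finP unfolding S_def by (auto simp: card_Diff_subset)
    have cS: "card (\<Union>S) = card S * a"
      using S finP dP P(1,2)
      by (intro card_Union_equal_blocks) (auto intro: pairwise_subset finite_subset)
    have vH: "v \<in> \<Union>H \<longleftrightarrow> U \<in> H"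
      using U H(1) disj by blast
    have same: "{w \<in> \<Union>P - U. (w \<in> \<Union>H) = (v \<in> \<Union>H)} = \<Union>S"
    proof (cases "U \<in> H")
      case True
      then show ?thesis
        unfolding vH S_def using H(1) U disj by auto
    next
      case False
      then show ?thesis
        unfolding vH S_def using H(1) U disj by auto
    qed
    have "vertex_defect G 2 f v = (\<Sum>w\<in>\<Union>P - U. 1 - \<bar>f v 1 - f w 1\<bar>)"
      using vertex_defect_two_colors[OF f vV] V unfolding N by auto
    also have "\<dots> = (\<Sum>w\<in>\<Union>P - U. if (w \<in> \<Union>H) = (v \<in> \<Union>H) then 1 else 0)"
      by (intro sum.cong refl) (simp add: f_def)
    also have "\<dots> = real (card (\<Union>S))"
      unfolding same[symmetric] using G(1) V
      by (subst sum.inter_filter[symmetric]) auto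
    also have "\<dots> \<le> real n * real a"
      unfolding cS using \<open>card S \<le> n\<close> by (simp add: mult_right_mono)
    finally show ?thesis .
  qed
  then have "coloring_defect G 2 f \<le> real n * real a"
    unfolding coloring_defect_def using G(1,3) by simp
  with f show ?thesis by blast
qed

theorem proposition6:
  fixes m a :: nat and G :: "('v, 'e) pre_digraph"
  assumes "1 \<le> m" and "1 \<le> a"
    and "complete_multipartite m a G"
  shows "min_defect G 2 = (of_int \<lceil>real m / 2\<rceil> - 1) * real a"
proof -
  obtain P where "graph G" and part: "partition_on (verts G) P" and "card P = m"
    and P: "\<forall>U\<in>P. card U = a"
    and arcs: "arcs_ends G = {(u, v) \<in> verts G \<times> verts G. \<not> (\<exists>U\<in>P. u \<in> U \<and> v \<in> U)}"
    using assms(3) unfolding complete_multipartite_def by blast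
  interpret graph G by fact
  define n where "n = (m - 1) div 2"
  have n: "2 * n + 1 \<le> m" "m \<le> 2 * n + 2"
    using assms(1) unfolding n_def by auto
  have "\<lceil>real m / 2\<rceil> = int n + 1"
    using n by (intro ceiling_unique) auto
  then have rhs: "(of_int \<lceil>real m / 2\<rceil> - 1) * real a = real n * real a"
    by simp
  have "P \<noteq> {}" "{} \<notin> P" "\<Union>P = verts G"
    using assms(1) \<open>card P = m\<close> part by (auto simp: partition_on_def)
  then have ne: "verts G \<noteq> {}" by (metis Union_empty_conv equals0I)
  have lower: "real n * real a \<le> coloring_defect G 2 f" if "fractional_coloring G 2 f" for f
    using coloring_defect_lower_bound[OF finite_verts part arcs P assms(2) _ that] n \<open>card P = m\<close>
    by simp
  obtain f where f: "fractional_coloring G 2 f" "coloring_defect G 2 f \<le> real n * real a"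
    using coloring_with_small_defect[OF finite_verts part ne arcs P assms(2), of n] n \<open>card P = m\<close>
    by auto
  have "coloring_defect G 2 f = real n * real a"
    using f(2) lower[OF f(1)] by (rule antisym)
  then show ?thesis
    unfolding min_defect_def rhs
    using f(1) lower by (intro Least_equality) auto
qed

end
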